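(* Let $G=(V,A)$ be a directed graph with $n=|V|$ and arc costs $c:A\to\mathbb{Z}_+$, let $s\neq t\in V$ be source and sink, $\lambda\in\mathbb{Z}^{n-1}$, $\varepsilon\ge 0$, and $B=(1+\varepsilon)\cdot f^*_\lambda(s,t)$. Then Algorithm 1 (the recursive procedure described in the context), started with the call $\mathrm{UNSSP}(G,s,t,[\,\cdot\,],0)$, correctly computes the set of all universal near shortest simple paths between $s$ and $t$, i.e. the set $\{P\in\mathcal{P}_{st} : f_\lambda(P)\le B\}$.
   Context: $\mathbb{Z}_+$ denotes the nonnegative integers. All paths are simple (no repeated vertices); $\mathcal{P}_{uv}$ is the set of all simple directed $u$-$v$-paths in $G$; $V(P)$ and $A(P)$ are the vertices and arcs of $P$; $l(P)\le n-1$ is the number of arcs of $P$. For a path $P$, let $c_{(i)}(P)$ be the $i$-th largest arc cost on $P$ for $1\le i\le l(P)$, and $c_{(i)}(P)=0$ for $l(P)<i\le n-1$. For $\lambda\in\mathbb{Z}^{n-1}$ put $f_\lambda(P)=\sum_{i=1}^{n-1}\lambda_i c_{(i)}(P)$. The Universal Shortest Path Problem USPP$(G,\lambda)$ is $\min_{P\in\mathcal{P}_{st}}f_\lambda(P)$; $f^*_\lambda(u,v)$ is the minimum of $f_\lambda$ over $\mathcal{P}_{uv}$. The value $f^*_\lambda(s,t)$ is given as input (so $\mathcal{P}_{st}\ne\emptyset$). A universal near shortest simple path is a $P\in\mathcal{P}_{st}$ with $f_\lambda(P)\le B=(1+\varepsilon)f^*_\lambda(s,t)$. $P\circ a$ denotes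 $P$ extended by arc $a$. Algorithm 1: procedure $\mathrm{UNSSP}(G,\text{source},\text{sink},P,D_\lambda)$. 1. If source $=$ sink, print $(P,D_\lambda)$. 2. Otherwise, for each arc $a=(\text{source},v)\in A$: if $v\notin V(P)$ and $\min_{P^*\in\mathcal{P}_{v,\text{sink}}}f_\lambda(P\circ a\circ P^* )\le B$, then append $a$ to $P$, set $D_\lambda\leftarrow f_\lambda(P)$ for the extended path $P$, call $\mathrm{UNSSP}(G,v,\text{sink},P,D_\lambda)$ recursively, and afterwards remove $a$ from $P$. Here $P$ is the current path from $s$ to the current source vertex (initially the empty path $[\,\cdot\,]$ at $s$, with $V(P)=\{s\}$). The minimum in step 2 is taken over those completions $P^*$ for which $P\circ a\circ P^*$ is simple (and is $+\infty$ if there are none): it is obtained by temporarily deleting all outgoing arcs of the vertices $v\in V(P)$ except for the arcs of $P\circ a$ and solving the universal shortest $s$-$t$-path problem in the remaining graph. The computed set is the set of printed paths. *)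

theory Defs
  imports "Graph_Theory.Pair_Digraph" "HOL-Library.Extended_Real"
begin

text \<open>A path is the list of its arcs, as in the walks of the digraph library; an arc is a pair
  of vertices. The empty list is the path consisting of its start vertex only.\<close>

definition simple_paths :: "'a pair_pre_digraph \<Rightarrow> 'a \<Rightarrow> 'a \<Rightarrow> ('a \<times> 'a) awalk set" where
  "simple_paths G u v = {p. pre_digraph.apath (with_proj G) u p v}"

definition path_verts :: "'a pair_pre_digraph \<Rightarrow> 'a \<Rightarrow> ('a \<times> 'a) awalk \<Rightarrow> 'a set" where
  "path_verts G u p = set (pre_digraph.awalk_verts (with_proj G) u p)"

definition ordered_cost :: "('a \<times> 'a \<Rightarrow> nat) \<Rightarrow> ('a \<times> 'a) awalk \<Rightarrow> nat \<Rightarrow> nat" where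
  "ordered_cost c p i =
     (if 1 \<le> i \<and> i \<le> length p then rev (sort (map c p)) ! (i - 1) else 0)"

text \<open>The vector \<open>\<lambda>\<close> is a function on the natural numbers of which only the values at
  \<open>1, \<dots>, n - 1\<close> are used.\<close>

definition univ_cost ::
  "'a pair_pre_digraph \<Rightarrow> ('a \<times> 'a \<Rightarrow> nat) \<Rightarrow> (nat \<Rightarrow> int) \<Rightarrow> ('a \<times> 'a) awalk \<Rightarrow> int" where
  "univ_cost G c lam p =
     (\<Sum>i = 1..card (pverts G) - 1. lam i * int (ordered_cost c p i))"

text \<open>Only meaningful if \<open>v\<close> is reachable from \<open>u\<close>: \<open>Min {}\<close> is unspecified.\<close>

definition univ_opt ::
  "'a pair_pre_digraph \<Rightarrow> ('a \<times> 'a \<Rightarrow> nat) \<Rightarrow> (nat \<Rightarrow> int) \<Rightarrow> 'a \<Rightarrow> 'a \<Rightarrow> int" where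
  "univ_opt G c lam u v = Min (univ_cost G c lam ` simple_paths G u v)"

text \<open>The minimum of \<open>f\<^sub>\<lambda>(P \<circ> a \<circ> P*)\<close> over the paths \<open>P*\<close> from the head of \<open>a\<close> to the sink
  that complete \<open>P \<circ> a\<close> to a simple path. It is extended real valued so that it is \<open>\<infinity>\<close> if there
  is no such \<open>P*\<close>; in a finite graph there are only finitely many, so the infimum is attained
  otherwise.\<close>

definition best_completion ::
  "'a pair_pre_digraph \<Rightarrow> ('a \<times> 'a \<Rightarrow> nat) \<Rightarrow> (nat \<Rightarrow> int) \<Rightarrow> 'a \<Rightarrow> 'a
    \<Rightarrow> ('a \<times> 'a) awalk \<Rightarrow> 'a \<times> 'a \<Rightarrow> ereal" where
  "best_completion G c lam s sink P a =
     (INF Q \<in> {Q \<in> simple_paths G (snd a) sink. P @ [a] @ Q \<in> simple_paths G s sink}.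
        ereal (real_of_int (univ_cost G c lam (P @ [a] @ Q))))"

lemma best_completion_leD:
  assumes "best_completion G c lam s sink P a \<le> ereal B"
  shows "\<exists>Q. P @ [a] @ Q \<in> simple_paths G s sink"
proof (rule ccontr)
  assume "\<not> ?thesis"
  then have "best_completion G c lam s sink P a = \<infinity>"
    by (simp add: best_completion_def top_ereal_def)
  with assms show False by simp
qed

text \<open>The result is the list of printed pairs \<open>(P, D)\<close>, in the order of printing. The arguments
  \<open>G\<close>, \<open>c\<close>, \<open>lam\<close>, \<open>B\<close> are the global data of the algorithm, \<open>s\<close> is the start vertex of \<open>P\<close>, and
  \<open>es\<close> lists the arcs of \<open>G\<close> in the order in which the loop visits them. Passing \<open>P @ [a]\<close> to the
  recursive call amounts to appending \<open>a\<close> before and removing it after that call.\<close>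

function unssp ::
  "'a pair_pre_digraph \<Rightarrow> ('a \<times> 'a \<Rightarrow> nat) \<Rightarrow> (nat \<Rightarrow> int) \<Rightarrow> real \<Rightarrow> 'a \<Rightarrow> ('a \<times> 'a) list
    \<Rightarrow> 'a \<Rightarrow> 'a \<Rightarrow> ('a \<times> 'a) awalk \<Rightarrow> int \<Rightarrow> (('a \<times> 'a) awalk \<times> int) list" where
  "unssp G c lam B s es source sink P D =
     (if source = sink then [(P, D)]
      else concat (map
        (\<lambda>a. if snd a \<notin> path_verts G s P \<and> best_completion G c lam s sink P a \<le> ereal B
             then unssp G c lam B s es (snd a) sink (P @ [a]) (univ_cost G c lam (P @ [a]))
             else [])
        (filter (\<lambda>a. fst a = source) es)))"
  by pat_completeness auto

termination
proof (relation "measure (\<lambda>(G, c, lam, B, s, es, source, sink, P, D).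
    card (snd ` set es - path_verts G s P))", goal_cases)
  case 1
  show ?case by simp
next
  case (2 G c lam B s es source sink P D a)
  then have a: "a \<in> set es" "snd a \<notin> path_verts G s P"
    and le: "best_completion G c lam s sink P a \<le> ereal B" by auto
  obtain Q where "P @ [a] @ Q \<in> simple_paths G s sink"
    using best_completion_leD[OF le] by (elim exE)
  then have cas: "pcas s (P @ [a] @ Q) sink"
    by (simp add: simple_paths_def pre_digraph.apath_def pre_digraph.awalk_def
        cas_with_proj_eq)
  have "set (pawalk_verts s (P @ [a])) = insert (snd a) (set (pawalk_verts s P))"
    if "pcas s (P @ [a] @ Q) sink" for s
    using that by (induction P arbitrary: s) auto
  with cas have eq: "path_verts G s (P @ [a]) = insert (snd a) (path_verts G s P)"
    by (simp add: path_verts_def awalk_verts_with_proj_eq)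
  have "snd ` set es - path_verts G s (P @ [a]) \<subset> snd ` set es - path_verts G s P"
    using a unfolding eq by blast
  then show ?case by (simp add: psubset_card_mono)
qed

declare unssp.simps [simp del]

end

theory Submission
  imports Defs
begin

text \<open>Call a prefix \<open>P\<close> viable if some near-shortest path extends it. The test before each
  recursive call checks exactly whether \<open>P @ [a]\<close> is viable, so by induction on the recursion a call
  with current path \<open>P\<close> prints precisely the near-shortest paths extending \<open>P\<close>: a proper
  extension of \<open>P\<close> is an extension of \<open>P @ [a]\<close> for a unique arc \<open>a\<close>, and no simple path
  properly extends one that already ends at the sink.\<close>

context pair_fin_digraph
begin

text \<open>The vertex list of \<open>Q\<close> begins at the junction \<open>u\<close>, which
  \<open>P\<close> contains as well; \<open>tl\<close> removes this one legitimate overlap.\<close>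

lemma simple_paths_append_iff:
  assumes "P \<in> simple_paths G s u"
  shows "P @ Q \<in> simple_paths G s v \<longleftrightarrow>
    Q \<in> simple_paths G u v \<and> path_verts G s P \<inter> set (tl (pawalk_verts u Q)) = {}"
proof -
  have "last (pawalk_verts s P) = u"
    using assms by (auto simp: simple_paths_def apath_def awalk_def)
  with assms show ?thesis
    by (auto simp: simple_paths_def path_verts_def apath_append_iff)
qed

text \<open>Cutting a simple path right after \<open>a\<close> leaves two simple paths that meet at
  the head of \<open>a\<close>. The first is the current path of the recursive call, the second the
  completion searched for in \<open>best_completion\<close>.\<close>

lemma simple_paths_snoc_if_append:
  assumes "P @ a # Q \<in> simple_paths G s v"
  shows "P @ [a] \<in> simple_paths G s (snd a)" "Q \<in> simple_paths G (snd a) v"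
proof -
  have "apath s ((P @ [a]) @ Q) v"
    using assms by (simp add: simple_paths_def)
  note split = apath_append_iff[THEN iffD1, OF this]
  have last: "last (pawalk_verts s (P @ [a])) = snd a"
    by (simp add: awlast_append)
  show "P @ [a] \<in> simple_paths G s (snd a)" "Q \<in> simple_paths G (snd a) v"
    using split[THEN conjunct1] split[THEN conjunct2, THEN conjunct1]
    unfolding last simple_paths_def mem_Collect_eq .
qed

text \<open>Ensures that the loop over the arcs leaving \<open>u\<close> and its test on the head of
  \<open>a\<close> discard no simple extension of \<open>P\<close>.\<close>

lemma simple_path_append_arc:
  assumes "P \<in> simple_paths G s u" and "P @ a # Q \<in> simple_paths G s v"
  shows "a \<in> parcs G" "fst a = u" "snd a \<notin> path_verts G s P"
proof -
  have Q: "apath u (a # Q) v" and disj: "path_verts G s P \<inter> set (pawalk_verts (snd a) Q) = {}"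
    using assms(2) unfolding simple_paths_append_iff[OF assms(1)] by (auto simp: simple_paths_def)
  then show "a \<in> parcs G" "fst a = u" by (simp_all add: apath_Cons_iff)
  have "snd a \<in> set (pawalk_verts (snd a) Q)" by (cases Q) (use Q in \<open>auto simp: apath_Cons_iff\<close>)
  with disj show "snd a \<notin> path_verts G s P" by blast
qed

text \<open>A nonempty walk from \<open>u\<close> back to \<open>u\<close> visits \<open>u\<close>
  twice, so it is not simple.\<close>

lemma simple_path_closed_iff:
  assumes "P \<in> simple_paths G s u"
  shows "P @ Q \<in> simple_paths G s u \<longleftrightarrow> Q = []"
proof (cases "Q = []")
  case False
  then show ?thesis
    using apath_nonempty_ends[of u Q u] unfolding simple_paths_append_iff[OF assms]
    by (auto simp: simple_paths_def)
qed (simp add: assms)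

text \<open>A finite digraph has finitely many simple paths, so the infimum is attained unless there
  is no completion; then it is \<infinity>, which exceeds the real bound \<open>B\<close>.\<close>

lemma best_completion_le_iff:
  "best_completion G c lam s sink P a \<le> ereal B \<longleftrightarrow>
    (\<exists>Q. P @ a # Q \<in> simple_paths G s sink \<and> real_of_int (univ_cost G c lam (P @ a # Q)) \<le> B)"
proof -
  define S where "S = {Q. P @ a # Q \<in> simple_paths G s sink}"
  let ?cost = "\<lambda>Q. ereal (real_of_int (univ_cost G c lam (P @ a # Q)))"
  have sub: "S \<subseteq> simple_paths G (snd a) sink"
    unfolding S_def using simple_paths_snoc_if_append(2) by blast
  then have "{Q \<in> simple_paths G (snd a) sink. P @ [a] @ Q \<in> simple_paths G s sink} = S"
    by (auto simp: S_def)
  then have best: "best_completion G c lam s sink P a = Inf (?cost ` S)"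
    by (simp add: best_completion_def)
  from sub have fin: "finite S"
    using apaths_finite unfolding simple_paths_def by (rule finite_subset)
  have "Inf (?cost ` S) \<le> ereal B \<longleftrightarrow> (\<exists>Q\<in>S. ?cost Q \<le> ereal B)"
  proof (cases "S = {}")
    case True
    then show ?thesis by (simp add: top_ereal_def)
  next
    case False
    with fin show ?thesis by (simp add: cInf_eq_Min Min_le_iff del: ereal_less_eq)
  qed
  then show ?thesis by (simp add: best S_def)
qed

end

text \<open>At the sink a call prints \<open>P\<close> without testing its cost, so the bound for
  that case has to come from the caller.\<close>

lemma unssp_prints_extensions:
  assumes "pair_fin_digraph G" and "set es = parcs G"
    and "P \<in> simple_paths G s u"
    and "u = sink \<Longrightarrow> real_of_int (univ_cost G c lam P) \<le> B"
  shows "fst ` set (unssp G c lam B s es u sink P D) =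
    {R \<in> simple_paths G s sink. real_of_int (univ_cost G c lam R) \<le> B \<and> (\<exists>Q. R = P @ Q)}"
  using assms
proof (induction G c lam B s es u sink P D rule: unssp.induct)
  case (1 G c lam B s es u sink P D)
  interpret pair_fin_digraph G by fact
  define near where "near = {R \<in> simple_paths G s sink. real_of_int (univ_cost G c lam R) \<le> B}"
  show ?case
  proof (cases "u = sink")
    case True
    then have "fst ` set (unssp G c lam B s es u sink P D) = {P}"
      by (subst unssp.simps) simp
    with True show ?thesis
      using "1.prems"(3,4) simple_path_closed_iff[OF "1.prems"(3)] by auto
  next
    case False
    define ok where "ok a \<longleftrightarrow> snd a \<notin> path_verts G s P
      \<and> best_completion G c lam s sink P a \<le> ereal B" for a
    have branch: "fst ` set (unssp G c lam B s es (snd a) sink (P @ [a]) (univ_cost G c lam (P @ [a])))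
        = {R \<in> near. \<exists>Q. R = P @ a # Q}" if a: "a \<in> set es" "fst a = u" "ok a" for a
    proof -
      obtain Q where Q: "P @ a # Q \<in> near"
        using a by (auto simp: ok_def best_completion_le_iff near_def)
      then have snoc: "P @ [a] \<in> simple_paths G s (snd a)"
        by (auto simp: near_def dest: simple_paths_snoc_if_append)
      \<comment> \<open>The test only bounds the cost of some completion \<open>Q\<close>. If
        \<open>a\<close> already ends at the sink, this \<open>Q\<close> is empty, and the bound is
        one for \<open>P @ [a]\<close> itself.\<close>
      have "real_of_int (univ_cost G c lam (P @ [a])) \<le> B" if "snd a = sink"
        using Q snoc simple_path_closed_iff[of "P @ [a]" s sink Q] that by (auto simp: near_def)
      then show ?thesis
        using "1.IH"[OF False _ _ "1.prems"(1,2) snoc] a by (simp add: ok_def near_def)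
    qed
    have split: "(\<exists>Q. R = P @ Q) \<longleftrightarrow> (\<exists>a\<in>set es. fst a = u \<and> ok a \<and> (\<exists>Q. R = P @ a # Q))"
      if R: "R \<in> near" for R
    proof
      assume "\<exists>Q. R = P @ Q"
      then obtain Q where Q: "R = P @ Q" by blast
      \<comment> \<open>Since \<open>u\<close> differs from \<open>sink\<close>, \<open>Q\<close> is
        nonempty, and its first arc is the branch in which \<open>R\<close> appears.\<close>
      have "Q \<in> simple_paths G u sink"
        using R simple_paths_append_iff[OF "1.prems"(3)] by (simp add: Q near_def)
      with False obtain a Q' where "Q = a # Q'"
        by (cases Q) (auto simp: simple_paths_def apath_Nil_iff)
      then show "\<exists>a\<in>set es. fst a = u \<and> ok a \<and> (\<exists>Q. R = P @ a # Q)"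
        \<comment> \<open>The remainder \<open>Q'\<close> of \<open>R\<close> is itself a completion
          within the bound, so \<open>a\<close> passes the test.\<close>
        using R Q "1.prems"(2) simple_path_append_arc[OF "1.prems"(3), of a Q' sink]
        by (auto simp: near_def ok_def best_completion_le_iff)
    qed blast
    have "fst ` set (unssp G c lam B s es u sink P D) = (\<Union>a\<in>{a \<in> set es. fst a = u \<and> ok a}.
        fst ` set (unssp G c lam B s es (snd a) sink (P @ [a]) (univ_cost G c lam (P @ [a]))))"
      using False by (subst unssp.simps) (auto simp: ok_def image_UN split: if_splits)
    also have "\<dots> = (\<Union>a\<in>{a \<in> set es. fst a = u \<and> ok a}. {R \<in> near. \<exists>Q. R = P @ a # Q})"
      using branch by (intro SUP_cong refl) blast
    also have "\<dots> = {R \<in> near. \<exists>Q. R = P @ Q}"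
      using split by blast
    finally show ?thesis by (simp add: near_def)
  qed
qed

theorem theorem3p11:
  fixes G :: "'a pair_pre_digraph"
    and c :: "'a \<times> 'a \<Rightarrow> nat"
    and lam :: "nat \<Rightarrow> int"
    and eps B :: real
    and s t :: 'a
    and es :: "('a \<times> 'a) list"
  assumes "pair_fin_digraph G"
    and "s \<in> pverts G" and "t \<in> pverts G" and "s \<noteq> t"
    and "simple_paths G s t \<noteq> {}"
    and "eps \<ge> 0"
    and "B = (1 + eps) * real_of_int (univ_opt G c lam s t)"
    and "distinct es" and "set es = parcs G"
  shows "fst ` set (unssp G c lam B s es s t [] 0) =
    {P \<in> simple_paths G s t. real_of_int (univ_cost G c lam P) \<le> B}"
proof -
  interpret pair_fin_digraph G by fact
  have "[] \<in> simple_paths G s s"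
    using assms(2) by (simp add: simple_paths_def apath_Nil_iff)
  \<comment> \<open>Every path extends the empty one, and the condition for a call at the sink is
    vacuous because \<open>s\<close> and \<open>t\<close> differ.\<close>
  then show ?thesis
    using unssp_prints_extensions[OF assms(1,9), of "[]" s s t c lam B 0] assms(4) by simp
qed

end
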